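(* Let $R$ be a finite commutative local principal ring. Denote by $\mathcal{I}$ and $\mathcal{N}$ the sets of idempotent and nilpotent matrices in $M_2(R)$, respectively. Then \[ \langle \mathcal{I}\cup\mathcal{N}\rangle=\langle\mathcal{I}\rangle\cup\langle\mathcal{N}\rangle . \] Moreover, if a product of elements of $\mathcal{I}\cup\mathcal{N}$ contains a nontrivial idempotent factor, then it is a product of two idempotents (of $M_2(R)$).
   Context: Rings are with identity; a principal ring is one in which every ideal is principal. $M_2(R)$ is the ring of $2\times 2$ matrices over $R$. For a subset $S\subseteq M_2(R)$, $\langle S\rangle$ denotes the set of all finite products $A_1A_2\cdots A_s$ ($s\ge 1$) with all $A_i\in S$. An idempotent matrix is nontrivial if it is different from $0$ and from the identity matrix $I$. *)

theory Defs
  imports "HOL-Analysis.Analysis" "HOL-Algebra.Algebraic_Closure_Type"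
begin

text \<open>
  The base ring is a type of class \<open>comm_ring_1\<close>; its ideals are those of HOL-Algebra, taken in
  the record \<open>ring_of_type_algebra\<close> (carrier \<open>UNIV\<close>, the operations of the class).
\<close>

definition local_ring :: "('a, 'b) ring_scheme \<Rightarrow> bool" where
  "local_ring R \<longleftrightarrow> cring R \<and> (\<exists>!M. maximalideal M R)"

definition principal_ring :: "('a, 'b) ring_scheme \<Rightarrow> bool" where
  "principal_ring R \<longleftrightarrow> cring R \<and> (\<forall>I. ideal I R \<longrightarrow> principalideal I R)"

text \<open>
  On \<open>'a^2^2\<close> the class operations \<open>*\<close>, \<open>1\<close> and \<open>^\<close> act entrywise, so all products below are built
  from the matrix product \<open>**\<close> and the identity matrix \<open>mat 1\<close>.
\<close>

definition mat_prod_list :: "(('a::comm_ring_1)^2^2) list \<Rightarrow> 'a^2^2" where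
  "mat_prod_list As = foldr (**) As (mat 1)"

definition mat_products :: "(('a::comm_ring_1)^2^2) set \<Rightarrow> ('a^2^2) set" where
  "mat_products S = {mat_prod_list As | As. As \<noteq> [] \<and> set As \<subseteq> S}"

definition idempotent_mats :: "(('a::comm_ring_1)^2^2) set" where
  "idempotent_mats = {A. A ** A = A}"

definition nilpotent_mats :: "(('a::comm_ring_1)^2^2) set" where
  "nilpotent_mats = {A. \<exists>k\<ge>1. mat_prod_list (replicate k A) = 0}"

definition nontrivial_idempotent_mats :: "(('a::comm_ring_1)^2^2) set" where
  "nontrivial_idempotent_mats = idempotent_mats - {0, mat 1}"

end

theory Submission
  imports Defs
begin

text \<open>
  Over a local ring a nontrivial idempotent \<open>2 \<times> 2\<close> matrix is an outer product \<open>x y\<^sup>T\<close> with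
  \<open>y\<^sup>T x = 1\<close>. Hence a product with such a factor is again an outer product \<open>v w\<^sup>T\<close>. As the ring is
  also principal, \<open>v w\<^sup>T = c x w'\<^sup>T\<close> with \<open>x\<close>, \<open>w'\<close> unimodular, and this equals
  \<open>(x y\<^sup>T) (z w'\<^sup>T)\<close> for any \<open>y\<close>, \<open>z\<close> with \<open>y\<^sup>T x = w'\<^sup>T z = 1\<close> and \<open>y\<^sup>T z = c\<close>; such
  \<open>y\<close>, \<open>z\<close> exist by locality. A product without nontrivial idempotent factors is \<open>1\<close> or a product of
  nilpotents, since \<open>0\<close> is nilpotent.
\<close>

section \<open>Locality and principality in terms of elements\<close>

lemma ring_of_type_algebra_simps [simp]:
  "carrier (ring_of_type_algebra :: 'a::comm_ring_1 ring) = UNIV"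
  "x \<otimes>\<^bsub>ring_of_type_algebra\<^esub> y = x * (y :: 'a::comm_ring_1)"
  "x \<oplus>\<^bsub>ring_of_type_algebra\<^esub> y = x + (y :: 'a::comm_ring_1)"
  "\<one>\<^bsub>ring_of_type_algebra\<^esub> = (1 :: 'a::comm_ring_1)"
  by (simp_all add: ring_of_type_algebra_def)

lemma mem_PIdl_iff: "x \<in> PIdl\<^bsub>ring_of_type_algebra\<^esub> a \<longleftrightarrow> (a :: 'a::comm_ring_1) dvd x"
  by (auto simp: cgenideal_def dvd_def mult.commute)

text \<open>A finite carrier has only finitely many ideals, so a maximal one among the proper ideals
  above \<open>I\<close> exists without Zorn's lemma.\<close>

lemma finite_ideal_le_maximalideal:
  assumes "finite (carrier R)" and "ideal I R" and "I \<noteq> carrier R"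
  obtains M where "maximalideal M R" and "I \<subseteq> M"
proof -
  let ?S = "{J. ideal J R \<and> J \<noteq> carrier R}"
  have "?S \<subseteq> Pow (carrier R)"
    by (auto dest: ideal.Icarr)
  then have "finite ?S"
    by (rule finite_subset) (simp add: assms(1))
  moreover have "I \<in> ?S" using assms by simp
  ultimately obtain M where M: "M \<in> ?S" "I \<subseteq> M" "\<forall>J\<in>?S. M \<subseteq> J \<longrightarrow> M = J"
    using finite_has_maximal2[of ?S I] by blast
  have "maximalideal M R"
  proof (rule maximalidealI)
    show "ideal M R" "carrier R \<noteq> M" using M(1) by auto
    show "J = M \<or> J = carrier R" if "ideal J R" "M \<subseteq> J" for J
      using M(3) that by blast
  qed
  then show ?thesis using M(2) by (rule that)
qed

text \<open>Two nonunits lie in the same maximal ideal, so they cannot sum to 1. This is the form in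
  which locality is used from here on.\<close>

lemma local_ring_unit_or_unit:
  assumes "local_ring (ring_of_type_algebra :: 'a::{finite, comm_ring_1} ring)"
  shows "(a :: 'a) dvd 1 \<or> (1 - a) dvd 1"
proof (rule ccontr)
  let ?R = "ring_of_type_algebra :: 'a ring"
  assume nonunits: "\<not> (a dvd 1 \<or> (1 - a) dvd 1)"
  interpret cring ?R ..
  have ex: "\<exists>M. maximalideal M ?R \<and> x \<in> M" if "\<not> x dvd 1" for x
  proof -
    have "ideal (PIdl\<^bsub>?R\<^esub> x) ?R"
      by (rule cgenideal_ideal) simp
    moreover have "PIdl\<^bsub>?R\<^esub> x \<noteq> carrier ?R"
      using that mem_PIdl_iff[of 1 x] by auto
    ultimately obtain M where "maximalideal M ?R" "PIdl\<^bsub>?R\<^esub> x \<subseteq> M"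
      using finite_ideal_le_maximalideal[of ?R] by auto
    then show ?thesis using mem_PIdl_iff[of x x] by auto
  qed
  obtain M where M: "maximalideal M ?R" "a \<in> M" "1 - a \<in> M"
    using ex[of a] ex[of "1 - a"] nonunits assms unfolding local_ring_def by blast
  interpret M: maximalideal M ?R by (rule M)
  have "1 \<in> M" using M.a_closed[OF M(2,3)] by simp
  then have "M = carrier ?R" using M.one_imp_carrier by simp
  then show False using M.I_notcarr by simp
qed

text \<open>\<open>d\<close> is a generator of the sum of the principal ideals of \<open>a\<close>
  and \<open>b\<close>.\<close>

lemma principal_ring_bezout:
  fixes a b :: "'a::comm_ring_1"
  assumes "principal_ring (ring_of_type_algebra :: 'a ring)"
  obtains r s d where "r * a + s * b = d" "d dvd a" "d dvd b"
proof -
  let ?R = "ring_of_type_algebra :: 'a ring"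
  interpret cring ?R ..
  let ?I = "PIdl\<^bsub>?R\<^esub> a <+>\<^bsub>?R\<^esub> PIdl\<^bsub>?R\<^esub> b"
  have memI: "x \<in> ?I \<longleftrightarrow> (\<exists>r s. x = r * a + s * b)" for x
    by (auto simp: set_add_def' cgenideal_def)
  have "ideal ?I ?R"
    by (intro add_ideals cgenideal_ideal) simp_all
  then have "principalideal ?I ?R"
    using assms by (simp add: principal_ring_def)
  then obtain d where "?I = Idl\<^bsub>?R\<^esub> {d}"
    using principalideal.generate by blast
  then have d: "x \<in> ?I \<longleftrightarrow> d dvd x" for x
    using cgenideal_eq_genideal[of d] mem_PIdl_iff[of x d] by simp
  have "a \<in> ?I" unfolding memI by (metis add.right_neutral mult_1 mult_zero_left)
  moreover have "b \<in> ?I" unfolding memI by (metis add.left_neutral mult_1 mult_zero_left)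
  moreover obtain r s where "d = r * a + s * b" using d[of d] memI[of d] by auto
  ultimately show ?thesis using that d by metis
qed

section \<open>Unimodular pairs\<close>

lemma unit_or_unit_of_lincomb:
  fixes x y :: "'a::comm_ring_1"
  assumes "\<And>a :: 'a. a dvd 1 \<or> (1 - a) dvd 1" and "(r * x + s * y) dvd 1"
  shows "x dvd 1 \<or> y dvd 1"
proof -
  obtain u where u: "(r * x + s * y) * u = 1"
    using assms(2) by (metis dvd_def)
  \<comment> \<open>The two scaled summands add up to 1, so one of them is a unit, and so is each of
    its factors.\<close>
  have "1 - x * (r * u) = y * (s * u)"
    using u by (simp add: algebra_simps)
  then show ?thesis
    using assms(1)[of "x * (r * u)"] by (metis dvd_mult_left)
qed

text \<open>Dividing by a Bezout divisor \<open>d\<close> gives \<open>d * (1 - ?u) = 0\<close>.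
  Either \<open>?u\<close> is a unit and the quotients are unimodular, or \<open>1 - ?u\<close> is a
  unit, which forces \<open>d = 0\<close>, and the pair (1, 0) serves.\<close>

lemma extract_unimodular:
  fixes v1 v2 :: "'a::comm_ring_1"
  assumes loc: "\<And>a :: 'a. a dvd 1 \<or> (1 - a) dvd 1"
    and "principal_ring (ring_of_type_algebra :: 'a ring)"
  obtains d x1 x2 where "v1 = d * x1" "v2 = d * x2" "x1 dvd 1 \<or> x2 dvd 1"
proof -
  obtain r s d where d: "r * v1 + s * v2 = d" "d dvd v1" "d dvd v2"
    using principal_ring_bezout[OF assms(2)] by blast
  then obtain x1 x2 where x: "v1 = d * x1" "v2 = d * x2" by (auto elim!: dvdE)
  let ?u = "r * x1 + s * x2"
  show ?thesis
  proof (cases "?u dvd 1")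
    case True
    then show ?thesis using that x unit_or_unit_of_lincomb[OF loc] by blast
  next
    case False
    then obtain g where "(1 - ?u) * g = 1" using loc[of ?u] by (metis dvd_def)
    moreover have "d * (1 - ?u) = 0" using d(1) x by (simp add: algebra_simps)
    ultimately have "d = 0" by (metis mult.assoc mult_1_right mult_zero_left)
    then show ?thesis using that[of 0 1 0] x by simp
  qed
qed

lemma interpolate_unit_fst:
  fixes x1 x2 w1 w2 c :: "'a::comm_ring_1"
  assumes loc: "\<And>a :: 'a. a dvd 1 \<or> (1 - a) dvd 1"
    and "x1 dvd 1" and "w1 dvd 1 \<or> w2 dvd 1"
  shows "\<exists>y1 y2 z1 z2. y1 * x1 + y2 * x2 = 1 \<and> w1 * z1 + w2 * z2 = 1 \<and> y1 * z1 + y2 * z2 = c"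
proof -
  obtain p where p: "x1 * p = 1" using assms(2) by (metis dvd_def)
  show ?thesis
  proof (cases "w2 dvd 1")
    case True
    then obtain q where q: "w2 * q = 1" by (metis dvd_def)
    have "p * x1 + 0 * x2 = x1 * p"
      "w1 * (x1 * c) + w2 * ((1 - w1 * (x1 * c)) * q)
        = w1 * (x1 * c) + (w2 * q) * (1 - w1 * (x1 * c))"
      "p * (x1 * c) + 0 * ((1 - w1 * (x1 * c)) * q) = (x1 * p) * c"
      by (simp_all add: algebra_simps)
    then have "p * x1 + 0 * x2 = 1" "w1 * (x1 * c) + w2 * ((1 - w1 * (x1 * c)) * q) = 1"
      "p * (x1 * c) + 0 * ((1 - w1 * (x1 * c)) * q) = c"
      unfolding p q by simp_all
    then show ?thesis by blast
  next
    case False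
    then obtain q where q: "w1 * q = 1" using assms(3) by (metis dvd_def)
    \<comment> \<open>As \<open>w2\<close> is a nonunit, locality makes
      \<open>1 + w2 * x2 * p * q\<close> a unit. It is the coefficient of \<open>b\<close> in
      \<open>b - x2 * p * a\<close> once \<open>a\<close> is solved from
      \<open>w1 * a + w2 * b = 1\<close>.\<close>
    have "\<not> w2 * (- (x2 * p * q)) dvd 1" using False dvd_mult_left by blast
    then obtain g where g: "(1 - w2 * (- (x2 * p * q))) * g = 1"
      using loc by (metis dvd_def)
    define b where "b = g * (1 + x2 * p * q)"
    define a where "a = q * (1 - w2 * b)"
    define s where "s = c - p * a"
    \<comment> \<open>\<open>b\<close> makes the coefficient of \<open>s\<close> in \<open>y\<^sup>T z\<close> equal to 1.\<close>
    have "b - x2 * p * a = ((1 - w2 * (- (x2 * p * q))) * g) * (1 + x2 * p * q) - x2 * p * q"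
      unfolding a_def b_def by (simp add: algebra_simps)
    then have 1: "b - x2 * p * a = 1" unfolding g by simp
    have "((1 - s * x2) * p) * x1 + s * x2 = (1 - s * x2) * (x1 * p) + s * x2"
      "w1 * a + w2 * b = (w1 * q) * (1 - w2 * b) + w2 * b"
      "((1 - s * x2) * p) * a + s * b = p * a + s * (b - x2 * p * a)"
      unfolding a_def by (simp_all add: algebra_simps)
    then have "((1 - s * x2) * p) * x1 + s * x2 = 1" "w1 * a + w2 * b = 1"
      "((1 - s * x2) * p) * a + s * b = c"
      unfolding 1 p q s_def by simp_all
    then show ?thesis by blast
  qed
qed

lemma interpolate_unimodular:
  fixes x1 x2 w1 w2 c :: "'a::comm_ring_1"
  assumes loc: "\<And>a :: 'a. a dvd 1 \<or> (1 - a) dvd 1"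
    and "x1 dvd 1 \<or> x2 dvd 1" and "w1 dvd 1 \<or> w2 dvd 1"
  shows "\<exists>y1 y2 z1 z2. y1 * x1 + y2 * x2 = 1 \<and> w1 * z1 + w2 * z2 = 1 \<and> y1 * z1 + y2 * z2 = c"
  using assms(2)
proof
  assume "x1 dvd 1"
  then show ?thesis using interpolate_unit_fst[OF loc] assms(3) by blast
next
  assume "x2 dvd 1"
  then obtain y1 y2 z1 z2
    where "y1 * x2 + y2 * x1 = 1" "w2 * z1 + w1 * z2 = 1" "y1 * z1 + y2 * z2 = c"
    using interpolate_unit_fst[OF loc, of x2 w2 w1 x1 c] assms(3) by blast
  then show ?thesis by (metis add.commute)
qed

section \<open>Outer products and idempotent matrices\<close>

definition outer :: "'a::comm_ring_1^'m \<Rightarrow> 'a^'n \<Rightarrow> 'a^'n^'m" where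
  "outer x y = (\<chi> i j. x $ i * y $ j)"

lemma matrix_mult_outer: "A ** outer x y = outer (A *v x) y"
  by (simp add: outer_def matrix_matrix_mult_def matrix_vector_mult_def sum_distrib_right
      mult.assoc)

lemma outer_matrix_mult: "outer x y ** A = outer x (y v* A)"
  by (simp add: outer_def matrix_matrix_mult_def vector_matrix_mult_def sum_distrib_left
      mult_ac)

lemma outer_mult_outer: "outer x y ** outer z w = outer ((\<Sum>i\<in>UNIV. y $ i * z $ i) *s x) w"
  by (simp add: matrix_mult_outer)
    (simp add: outer_def matrix_vector_mult_def vec_eq_iff sum_distrib_left sum_distrib_right
      mult_ac)

lemma idempotent_matD:
  fixes A :: "'a::comm_ring_1^2^2"
  assumes "A \<in> idempotent_mats"
  shows "A$1$1 * A$1$1 + A$1$2 * A$2$1 = A$1$1" "A$1$1 * A$1$2 + A$1$2 * A$2$2 = A$1$2"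
    "A$2$1 * A$1$1 + A$2$2 * A$2$1 = A$2$1" "A$2$1 * A$1$2 + A$2$2 * A$2$2 = A$2$2"
  using assms
  by (simp_all add: idempotent_mats_def matrix_matrix_mult_def vec_eq_iff forall_2 sum_2)

text \<open>Determinant and trace decide. The determinant is idempotent, hence 0 or 1, and 1 forces
  the identity. If it is 0, the trace is idempotent too: trace 0 forces \<open>A = 0\<close>, while
  trace 1 makes a diagonal entry a unit, and its row spans the other row.\<close>

lemma idempotent_mat_cases:
  fixes A :: "'a::comm_ring_1^2^2"
  assumes loc: "\<And>a :: 'a. a dvd 1 \<or> (1 - a) dvd 1"
    and A: "A \<in> idempotent_mats"
  shows "A = 0 \<or> A = mat 1 \<or> (\<exists>x y. A = outer x y)"
proof -
  \<comment> \<open>In \<open>e * (1 - e) = 0\<close> one of the factors is a unit and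
    cancels.\<close>
  have idem: "e = 0 \<or> e = 1" if "e * e = e" for e :: 'a
    using loc[of e]
  proof
    assume "e dvd 1"
    then obtain u where "e * u = 1" by (metis dvd_def)
    then have "e = e * (e * u)" by simp
    also have "\<dots> = (e * e) * u" by (simp add: mult.assoc)
    finally show ?thesis using that \<open>e * u = 1\<close> by simp
  next
    assume "(1 - e) dvd 1"
    then obtain u where "(1 - e) * u = 1" by (metis dvd_def)
    then have "e = e * ((1 - e) * u)" by simp
    also have "\<dots> = (e - e * e) * u" by (simp add: algebra_simps)
    finally show ?thesis using that by simp
  qed
  define a b c d where defs: "a = A$1$1" "b = A$1$2" "c = A$2$1" "d = A$2$2"
  note eqs = idempotent_matD[OF A, folded defs]
  have ent: "A = B \<longleftrightarrow> a = B$1$1 \<and> b = B$1$2 \<and> c = B$2$1 \<and> d = B$2$2" for B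
    by (auto simp: vec_eq_iff forall_2 defs)
  \<comment> \<open>Multiplicativity of the determinant, applied to \<open>A ** A\<close>.\<close>
  have "(a * d - b * c) * (a * d - b * c)
      = (a * a + b * c) * (c * b + d * d) - (a * b + b * d) * (c * a + d * c)"
    by (simp add: algebra_simps)
  then have "(a * d - b * c) * (a * d - b * c) = a * d - b * c"
    by (simp add: eqs)
  then consider (unit) "a * d - b * c = 1" | (sing) "a * d - b * c = 0"
    using idem by blast
  then show ?thesis
  proof cases
    case unit
    \<comment> \<open>Entries of det(A) A, written as adj(A) A^2 or A^2 adj(A). Replacing A^2 by A
      turns the right sides into entries of det(A) I.\<close>
    have "b * (a * d - b * c) = d * (a * b + b * d) - b * (c * b + d * d)"
      "c * (a * d - b * c) = a * (c * a + d * c) - c * (a * a + b * c)"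
      "d * (a * d - b * c) = a * (c * b + d * d) - b * (c * a + d * c)"
      by (simp_all add: algebra_simps)
    then have "b = 0" "c = 0" "d = 1"
      unfolding eqs unit by (simp_all add: mult.commute)
    then show ?thesis using unit by (simp add: ent mat_def)
  next
    case sing
    \<comment> \<open>The identity tr(A)^2 = tr(A^2) + 2 det(A).\<close>
    have "(a + d) * (a + d) = (a * a + b * c) + (c * b + d * d) + 2 * (a * d - b * c)"
      by (simp add: algebra_simps)
    then have "(a + d) * (a + d) = a + d" by (simp add: eqs sing)
    then consider (zero) "a + d = 0" | (one) "a + d = 1" using idem by blast
    then show ?thesis
    proof cases
      case zero
      \<comment> \<open>Cayley-Hamilton, A^2 = tr(A) A - det(A) I, by entries; here it gives A^2 =
        0.\<close>
      have "a * a + b * c = a * (a + d) - (a * d - b * c)" "a * b + b * d = b * (a + d)"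
        "c * a + d * c = c * (a + d)" "c * b + d * d = d * (a + d) - (a * d - b * c)"
        by (simp_all add: algebra_simps)
      then have "a = 0" "b = 0" "c = 0" "d = 0"
        unfolding eqs zero sing by simp_all
      then show ?thesis by (simp add: ent)
    next
      case one
      then have "d = 1 - a" by (simp add: algebra_simps)
      then consider u where "1 = a * u" | u where "1 = d * u"
        using loc[of a] by (auto elim!: dvdE)
      then show ?thesis
      proof cases
        case 1
        \<comment> \<open>Since the determinant vanishes, the second row is \<open>c * u\<close>
          times the first.\<close>
        have "c = c * u * a" "d = c * u * b"
        proof -
          have "c * u * a = c * (a * u)" "c * u * b = d * (a * u) - u * (a * d - b * c)"
            by (simp_all add: algebra_simps)
          then show "c = c * u * a" "d = c * u * b" unfolding 1[symmetric] sing by simp_all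
        qed
        then have "A = outer (vector [1, c * u]) (vector [a, b])"
          by (simp add: ent outer_def)
        then show ?thesis by blast
      next
        case 2
        have "a = b * u * c" "b = b * u * d"
        proof -
          have "b * u * c = a * (d * u) - u * (a * d - b * c)" "b * u * d = b * (d * u)"
            by (simp_all add: algebra_simps)
          then show "a = b * u * c" "b = b * u * d" unfolding 2[symmetric] sing by simp_all
        qed
        then have "A = outer (vector [b * u, 1]) (vector [c, d])"
          by (simp add: ent outer_def)
        then show ?thesis by blast
      qed
    qed
  qed
qed

lemma outer_eq_idempotent_mult_idempotent:
  fixes v w :: "'a::comm_ring_1^2"
  assumes loc: "\<And>a :: 'a. a dvd 1 \<or> (1 - a) dvd 1"
    and pr: "principal_ring (ring_of_type_algebra :: 'a ring)"
  shows "\<exists>E\<in>idempotent_mats. \<exists>F\<in>idempotent_mats. outer v w = E ** F"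
proof -
  obtain d x1 x2 where v: "v$1 = d * x1" "v$2 = d * x2" "x1 dvd 1 \<or> x2 dvd 1"
    using extract_unimodular[OF loc pr] by metis
  obtain e w1 w2 where w: "w$1 = e * w1" "w$2 = e * w2" "w1 dvd 1 \<or> w2 dvd 1"
    using extract_unimodular[OF loc pr] by metis
  \<comment> \<open>The prescribed value \<open>d * e\<close> restores, in \<open>?E ** ?F\<close>,
    the scalars split off from \<open>v\<close> and \<open>w\<close>.\<close>
  obtain y1 y2 z1 z2 where yz: "y1 * x1 + y2 * x2 = 1" "w1 * z1 + w2 * z2 = 1"
    "y1 * z1 + y2 * z2 = d * e"
    using interpolate_unimodular[OF loc v(3) w(3)] by metis
  let ?E = "outer (vector [x1, x2]) (vector [y1, y2]) :: 'a^2^2"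
  let ?F = "outer (vector [z1, z2]) (vector [w1, w2]) :: 'a^2^2"
  have "?E \<in> idempotent_mats"
    using yz(1) by (simp add: idempotent_mats_def outer_mult_outer sum_2)
  moreover have "?F \<in> idempotent_mats"
    using yz(2) by (simp add: idempotent_mats_def outer_mult_outer sum_2)
  moreover have "outer v w = ?E ** ?F"
    unfolding outer_mult_outer sum_2
    using yz(3) v w by (simp add: outer_def vec_eq_iff forall_2 mult_ac)
  ultimately show ?thesis by blast
qed

section \<open>Products of idempotents and nilpotents\<close>

lemma mat_prod_list_simps [simp]:
  "mat_prod_list [] = mat 1"
  "mat_prod_list (A # As) = A ** mat_prod_list As"
  by (simp_all add: mat_prod_list_def)

lemma mat_prod_list_append: "mat_prod_list (As @ Bs) = mat_prod_list As ** mat_prod_list Bs"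
  by (induction As) (simp_all add: matrix_mul_assoc)

lemma mat_prod_list_filter_ne_1:
  "mat_prod_list (filter (\<lambda>A. A \<noteq> mat 1) As) = mat_prod_list As"
  by (induction As) auto

lemma zero_nilpotent: "0 \<in> nilpotent_mats"
  unfolding nilpotent_mats_def by (auto intro!: exI[of _ 1])

lemma one_idempotent: "mat 1 \<in> idempotent_mats"
  by (simp add: idempotent_mats_def)

lemma mat_products_mono: "S \<subseteq> T \<Longrightarrow> mat_products S \<subseteq> mat_products T"
  unfolding mat_products_def by blast

text \<open>The factors on either side of an outer product are absorbed into its two
  vectors.\<close>

lemma mat_prod_list_with_nontrivial_idempotent:
  fixes As :: "('a::comm_ring_1^2^2) list"
  assumes loc: "\<And>a :: 'a. a dvd 1 \<or> (1 - a) dvd 1"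
    and pr: "principal_ring (ring_of_type_algebra :: 'a ring)"
    and "set As \<inter> nontrivial_idempotent_mats \<noteq> {}"
  shows "\<exists>E\<in>idempotent_mats. \<exists>F\<in>idempotent_mats. mat_prod_list As = E ** F"
proof -
  obtain A where A: "A \<in> set As" "A \<in> idempotent_mats" "A \<noteq> 0" "A \<noteq> mat 1"
    using assms(3) by (auto simp: nontrivial_idempotent_mats_def)
  obtain x y where "A = outer x y"
    using idempotent_mat_cases[OF loc] A by blast
  moreover obtain Bs Cs where "As = Bs @ A # Cs"
    using A(1) by (meson split_list)
  ultimately have "mat_prod_list As = outer (mat_prod_list Bs *v x) (y v* mat_prod_list Cs)"
    by (simp add: mat_prod_list_append matrix_mult_outer outer_matrix_mult)
  then show ?thesis
    using outer_eq_idempotent_mult_idempotent[OF loc pr] by simp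
qed

lemma mat_prod_list_without_nontrivial_idempotent:
  assumes "set As \<subseteq> idempotent_mats \<union> nilpotent_mats"
    and "set As \<inter> nontrivial_idempotent_mats = {}"
  shows "mat_prod_list As = mat 1 \<or> mat_prod_list As \<in> mat_products nilpotent_mats"
proof -
  let ?Bs = "filter (\<lambda>A. A \<noteq> mat 1) As"
  have "set ?Bs \<subseteq> nilpotent_mats"
    using assms zero_nilpotent by (auto simp: nontrivial_idempotent_mats_def)
  \<comment> \<open>The empty list is kept apart because \<open>mat_products\<close> admits only
    nonempty lists.\<close>
  then have "?Bs = [] \<or> mat_prod_list ?Bs \<in> mat_products nilpotent_mats"
    unfolding mat_products_def by blast
  then show ?thesis
    using mat_prod_list_filter_ne_1[of As] by (metis mat_prod_list_simps(1))
qed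

theorem theorem3p3:
  assumes "local_ring (ring_of_type_algebra :: ('a::{finite, comm_ring_1}) ring)"
    and "principal_ring (ring_of_type_algebra :: 'a ring)"
  shows "mat_products (idempotent_mats \<union> nilpotent_mats :: ('a^2^2) set) =
      mat_products idempotent_mats \<union> mat_products nilpotent_mats \<and>
    (\<forall>As :: ('a^2^2) list.
      set As \<subseteq> idempotent_mats \<union> nilpotent_mats \<and> set As \<inter> nontrivial_idempotent_mats \<noteq> {} \<longrightarrow>
      (\<exists>E\<in>idempotent_mats. \<exists>F\<in>idempotent_mats. mat_prod_list As = E ** F))"
proof
  note loc = local_ring_unit_or_unit[OF assms(1)]
  note main = mat_prod_list_with_nontrivial_idempotent[OF loc assms(2)]
  show "\<forall>As :: ('a^2^2) list.
      set As \<subseteq> idempotent_mats \<union> nilpotent_mats \<and> set As \<inter> nontrivial_idempotent_mats \<noteq> {} \<longrightarrow>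
      (\<exists>E\<in>idempotent_mats. \<exists>F\<in>idempotent_mats. mat_prod_list As = E ** F)"
    using main by blast
  have idem_products: "mat_prod_list As \<in> mat_products idempotent_mats"
    if "As \<noteq> []" "set As \<subseteq> idempotent_mats" for As :: "('a^2^2) list"
    using that unfolding mat_products_def by blast
  have "mat_prod_list As \<in> mat_products idempotent_mats \<union> mat_products nilpotent_mats"
    if As: "set As \<subseteq> idempotent_mats \<union> nilpotent_mats" for As :: "('a^2^2) list"
  proof (cases "set As \<inter> nontrivial_idempotent_mats = {}")
    case True
    \<comment> \<open>If the product is \<open>mat 1\<close>, it counts as a product of one
      idempotent.\<close>
    then show ?thesis
      using mat_prod_list_without_nontrivial_idempotent[OF As] one_idempotent
        idem_products[of "[mat 1]"] by auto
  next
    case False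
    then obtain E F where "E \<in> idempotent_mats" "F \<in> idempotent_mats" "mat_prod_list As = E ** F"
      using main by blast
    then show ?thesis using idem_products[of "[E, F]"] by simp
  qed
  then have "mat_products (idempotent_mats \<union> nilpotent_mats :: ('a^2^2) set)
      \<subseteq> mat_products idempotent_mats \<union> mat_products nilpotent_mats"
    unfolding mat_products_def[of "idempotent_mats \<union> nilpotent_mats"] by blast
  then show "mat_products (idempotent_mats \<union> nilpotent_mats :: ('a^2^2) set) =
      mat_products idempotent_mats \<union> mat_products nilpotent_mats"
    by (intro equalityI Un_least mat_products_mono) auto
qed

end
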